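(* Let $\alpha<1$ and $\beta>1$ be real numbers. The logarithmic coefficients $\gamma_n$ of every $f\in\mathcal{S}(\alpha,\beta)$ satisfy $$\sum_{n=1}^{\infty}|\gamma_n|^2\leq \frac{(\beta-\alpha)^2}{4\pi^2}\left(\frac{\pi^4}{45}-Li_4\left(e^{-2\pi i\frac{1-\alpha}{\beta-\alpha}}\right)-Li_4\left(e^{2\pi i\frac{1-\alpha}{\beta-\alpha}}\right)\right).$$ The result is sharp, i.e. for all such $\alpha,\beta$ there is a function $f\in\mathcal{S}(\alpha,\beta)$ for which equality holds.
   Context: $\Delta=\{z\in\mathbb{C}:|z|<1\}$ is the open unit disc. $\mathcal{A}$ is the class of functions $f$ analytic in $\Delta$ with $f(0)=0$ and $f'(0)=1$. For real $\alpha<1$ and $\beta>1$, $\mathcal{S}(\alpha,\beta)$ is the class of all $f\in\mathcal{A}$ such that $\alpha<\mathrm{Re}\{zf'(z)/f(z)\}<\beta$ for all $z\in\Delta$. Here $zf'(z)/f(z)$ is analytic in $\Delta$ with value $1$ at $z=0$; in particular $f(z)\neq0$ for $z\in\Delta\setminus\{0\}$. The logarithmic coefficients $\gamma_n=\gamma_n(f)$ ($n\ge1$) of such an $f$ are defined by $$\log\left\{\frac{f(z)}{z}\right\}=\sum_{n=1}^{\infty}2\gamma_n z^n\quad(z\in\Delta),$$ where $f(z)/z$ has value $1$ at $z=0$ and $\log\{f(z)/z\}$ is its analytic logarithm on $\Delta$ vanishing at $z=0$. For $|z|\le1$, $$Li_4(z)=\sum_{n=1}^{\infty}\frac{z^n}{n^4}=-\frac{1}{2}\int_{0}^{1}\frac{\log^2(1/t)\log(1-tz)}{t}\,{\rm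 d}t.$$ *)

theory Defs
  imports "HOL-Complex_Analysis.Complex_Analysis"
begin

abbreviation unit_disc :: "complex set" where
  "unit_disc \<equiv> ball 0 1"

definition class_A :: "(complex \<Rightarrow> complex) set" where
  "class_A = {f. f holomorphic_on unit_disc \<and> f 0 = 0 \<and> deriv f 0 = 1}"

text \<open>
  The nonvanishing of \<open>f\<close> off the origin is what makes \<open>z f'(z) / f(z)\<close> a function on the punctured
  disc. It has to be stated because of the convention \<open>x / 0 = 0\<close>: for negative \<open>\<alpha>\<close> a zero of \<open>f\<close>
  would otherwise pass the test. The value of the quotient at the origin is \<open>1\<close>.
\<close>
definition class_S :: "real \<Rightarrow> real \<Rightarrow> (complex \<Rightarrow> complex) set" where
  "class_S \<alpha> \<beta> = {f \<in> class_A.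
     (\<forall>z\<in>unit_disc - {0}. f z \<noteq> 0) \<and>
     (\<forall>z\<in>unit_disc.
        let q = (if z = 0 then 1 else z * deriv f z / f z) in \<alpha> < Re q \<and> Re q < \<beta>)}"

text \<open>\<open>L\<close> is the analytic branch of \<open>log (f(z) / z)\<close> on the disc that vanishes at the origin.\<close>
definition is_log_quotient :: "(complex \<Rightarrow> complex) \<Rightarrow> (complex \<Rightarrow> complex) \<Rightarrow> bool" where
  "is_log_quotient f L \<longleftrightarrow>
     L holomorphic_on unit_disc \<and> L 0 = 0 \<and>
     (\<forall>z\<in>unit_disc. exp (L z) = (if z = 0 then 1 else f z / z))"

text \<open>
  The logarithmic coefficients start at index \<open>1\<close>; the unused value at \<open>0\<close> is fixed to be \<open>0\<close>, so that
  the sequence is uniquely determined (see \<open>ex1_log_coeffs\<close> below).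
\<close>
definition is_log_coeffs :: "(complex \<Rightarrow> complex) \<Rightarrow> (nat \<Rightarrow> complex) \<Rightarrow> bool" where
  "is_log_coeffs f \<gamma> \<longleftrightarrow> \<gamma> 0 = 0 \<and>
     (\<exists>L. is_log_quotient f L \<and>
          (\<forall>z\<in>unit_disc. (\<lambda>n. 2 * \<gamma> (Suc n) * z ^ Suc n) sums L z))"

definition log_coeff :: "(complex \<Rightarrow> complex) \<Rightarrow> nat \<Rightarrow> complex" where
  "log_coeff f = (THE \<gamma>. is_log_coeffs f \<gamma>)"

text \<open>Only used for \<open>|z| \<le> 1\<close>, where the series converges.\<close>
definition Li4 :: "complex \<Rightarrow> complex" where
  "Li4 z = (\<Sum>n. z ^ Suc n / of_nat (Suc n) ^ 4)"

lemma ex_log_quotient: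
  assumes "f \<in> class_S \<alpha> \<beta>"
  shows "\<exists>L. is_log_quotient f L"
proof -
  have hol: "f holomorphic_on ball 0 1" and f0: "f 0 = 0" and d: "deriv f 0 = 1"
    and nz: "\<And>z. z \<in> ball 0 1 \<Longrightarrow> z \<noteq> 0 \<Longrightarrow> f z \<noteq> 0"
    using assms by (auto simp: class_S_def class_A_def)
  define h where "h = (\<lambda>z. if z = 0 then 1 else f z / z)"
  have h: "h holomorphic_on ball 0 1"
    using pole_theorem_0[OF hol, of 0 h] f0 d by (auto simp: h_def)
  have hnz: "h z \<noteq> 0" if "z \<in> ball 0 1" for z
    using nz that by (auto simp: h_def)
  obtain g where g: "g holomorphic_on ball 0 1" "\<And>z. z \<in> ball 0 1 \<Longrightarrow> h z = exp (g z)"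
    using contractible_imp_holomorphic_log[OF h] hnz
    by (metis convex_imp_contractible convex_ball)
  have "exp (g 0) = 1"
    using g(2)[of 0] by (simp add: h_def)
  then have "is_log_quotient f (\<lambda>z. g z - g 0)"
    using g by (auto simp: is_log_quotient_def exp_diff h_def intro!: holomorphic_intros)
  then show ?thesis by blast
qed

lemma log_quotient_unique:
  assumes "is_log_quotient f L" "is_log_quotient f M" "z \<in> unit_disc"
  shows "L z = M z"
proof -
  define D where "D = (\<lambda>z. L z - M z)"
  have hol: "D holomorphic_on ball 0 1"
    using assms by (auto simp: D_def is_log_quotient_def intro!: holomorphic_intros)
  have e: "exp (D w) = 1" if "w \<in> ball 0 1" for w
  proof -
    have "exp (L w) = exp (M w)"
      using assms that by (auto simp: is_log_quotient_def)
    then show ?thesis by (simp add: D_def exp_diff)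
  qed
  have "(D has_field_derivative 0) (at w within ball 0 1)" if w: "w \<in> ball 0 1" for w
  proof -
    have *: "(D has_field_derivative deriv D w) (at w)"
      using hol w holomorphic_derivI by blast
    then have "((\<lambda>w. exp (D w)) has_field_derivative exp (D w) * deriv D w) (at w)"
      by (auto intro!: derivative_eq_intros)
    moreover have "((\<lambda>w. exp (D w)) has_field_derivative 0) (at w)"
      by (rule has_field_derivative_transform_within_open[where S = "ball 0 1" and f = "\<lambda>_. 1"])
         (use w e in auto)
    ultimately have "deriv D w = 0"
      by (metis DERIV_unique exp_not_eq_zero mult_eq_0_iff)
    then show ?thesis using * by (metis has_field_derivative_at_within)
  qed
  then have "D z = D 0"
    using has_field_derivative_zero_constant[of "ball 0 1" D] assms(3)
    by (metis centre_in_ball convex_ball zero_less_one)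
  then show ?thesis
    using assms by (simp add: D_def is_log_quotient_def)
qed

lemma ex1_log_coeffs:
  assumes "f \<in> class_S \<alpha> \<beta>"
  shows "\<exists>!\<gamma>. is_log_coeffs f \<gamma>"
proof -
  obtain L where L: "is_log_quotient f L"
    using ex_log_quotient[OF assms] by blast
  define a where "a = (\<lambda>n. (deriv ^^ n) L 0 / fact n)"
  have a0: "a 0 = 0" using L by (simp add: a_def is_log_quotient_def)
  have a: "(\<lambda>n. a n * z ^ n) sums L z" if "z \<in> ball 0 1" for z
    using holomorphic_power_series[of L 0 1 z] L that
    by (simp add: a_def is_log_quotient_def)
  have "is_log_coeffs f (\<lambda>n. a n / 2)"
    unfolding is_log_coeffs_def
  proof (intro conjI exI ballI)
    fix z :: complex assume "z \<in> ball 0 1"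
    then show "(\<lambda>n. 2 * (a (Suc n) / 2) * z ^ Suc n) sums L z"
      using sums_Suc_iff[of "\<lambda>n. a n * z ^ n" "L z"] a[of z] a0 by simp
  qed (use L a0 in auto)
  moreover have "\<gamma> = (\<lambda>n. a n / 2)" if \<gamma>: "is_log_coeffs f \<gamma>" for \<gamma>
  proof -
    obtain M where M: "is_log_quotient f M"
      and s: "\<And>z. z \<in> ball 0 1 \<Longrightarrow> (\<lambda>n. 2 * \<gamma> (Suc n) * z ^ Suc n) sums M z"
      and g0: "\<gamma> 0 = 0"
      using \<gamma> unfolding is_log_coeffs_def by blast
    have s': "(\<lambda>n. 2 * \<gamma> n * z ^ n) sums L z" if "z \<in> ball 0 1" for z
      using s[OF that] g0 log_quotient_unique[OF L M that]
        sums_Suc_iff[of "\<lambda>n. 2 * \<gamma> n * z ^ n" "L z"] by simp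
    have "(\<lambda>n. (2 * \<gamma> n - a n) * z ^ n) sums 0" if "norm z < 1" for z
      using sums_diff[OF s'[of z] a[of z]] that by (simp add: algebra_simps)
    then have "eventually (\<lambda>z. (\<lambda>n. fps_nth (Abs_fps (\<lambda>n. 2 * \<gamma> n - a n)) n * z ^ n) sums 0) (nhds 0)"
      by (intro eventually_nhds_in_open[of "ball 0 1", THEN eventually_mono]) auto
    then have "(\<lambda>_. 0) has_fps_expansion Abs_fps (\<lambda>n. 2 * \<gamma> n - a n)"
      by (rule has_fps_expansionI)
    then have "Abs_fps (\<lambda>n. 2 * \<gamma> n - a n) = 0"
      using fps_expansion_unique_complex has_fps_expansion_0 by blast
    then have "2 * \<gamma> n - a n = 0" for n
      by (metis fps_nth_Abs_fps fps_zero_nth)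
    then show ?thesis by (auto simp: fun_eq_iff field_simps)
  qed
  ultimately show ?thesis by blast
qed

end

theory Submission
  imports Defs
begin

text \<open>
  If \<open>L\<close> is the logarithm of \<open>f(z)/z\<close>, then \<open>z L' = z f'/f - 1\<close> is subordinate to
  \<open>q(z) = i (\<beta> - \<alpha>)/\<pi> \<cdot> log ((1 - c z)/(1 - z))\<close> with \<open>c = exp (2 \<pi> i (1 - \<alpha>)/(\<beta> - \<alpha>))\<close>, the conformal
  map of the disc onto the strip \<open>\<alpha> - 1 < Re w < \<beta> - 1\<close>. The coefficients of \<open>z L'\<close> are \<open>2 n \<gamma>\<^sub>n\<close>, so
  Rogosinski's theorem bounds the partial sums of \<open>|2 n \<gamma>\<^sub>n|\<^sup>2\<close> by those of the squared coefficients
  of \<open>q\<close>. Summation by parts with the weights \<open>1/n\<^sup>2\<close> gives the inequality, with equality for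
  \<open>z L' = q\<close>; the value of the bound uses \<open>\<zeta>(4) = \<pi>\<^sup>4/90\<close>.
\<close>

section \<open>The value of the zeta function at 4\<close>

text \<open>Differentiate the reflection formula of the Gamma function logarithmically and then three more
  times, and evaluate at \<open>1/2\<close>.\<close>
lemma odd_inverse_fourth_powers_sums:
  "(\<lambda>k. 1 / (2 * real k + 1) ^ 4) sums (pi ^ 4 / 96)"
proof -
  \<comment> \<open>This strip is open, contains 1/2, is symmetric under z -> 1 - z, and avoids the
    poles of \<open>Gamma z\<close> and \<open>Gamma (1 - z)\<close> and the zeros of sin (pi
    z).\<close>
  define S where "S = {z :: complex. 0 < Re z \<and> Re z < 1}"
  have "S = {z. 0 < Re z} \<inter> {z. Re z < 1}" by (auto simp: S_def)
  then have S: "open S"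
    by (simp add: open_Int open_halfspace_Re_gt open_halfspace_Re_lt)
  have nonpos: "z \<notin> \<int>\<^sub>\<le>\<^sub>0" "1 - z \<notin> \<int>\<^sub>\<le>\<^sub>0" if "z \<in> S" for z
  proof -
    show "z \<notin> \<int>\<^sub>\<le>\<^sub>0" using that by (auto simp: S_def elim!: nonpos_Ints_cases')
    show "1 - z \<notin> \<int>\<^sub>\<le>\<^sub>0"
    proof
      assume "1 - z \<in> \<int>\<^sub>\<le>\<^sub>0"
      then obtain n where "1 - z = - of_nat n" by (auto elim!: nonpos_Ints_cases')
      then have "Re (1 - z) = - real n" by simp
      then show False using that by (auto simp: S_def)
    qed
  qed
  have sin_nz: "sin (of_real pi * z) \<noteq> 0" if "z \<in> S" for z
  proof
    assume "sin (of_real pi * z) = 0"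
    then obtain n :: int where "z = of_int n"
      by (auto simp: sin_eq_0)
    then have "0 < n \<and> n < 1" using that by (simp add: S_def)
    then show False by linarith
  qed
  \<comment> \<open>Functions agreeing on the open strip have equal derivatives there. This turns
    the reflection formula into \<open>r0\<close> and then each of \<open>r0\<close>,
    \<open>r1\<close>, \<open>r2\<close> into the next identity.\<close>
  have deriv_eq: "f' = g'" if "(f has_field_derivative f') (at z)" "(g has_field_derivative g') (at z)"
    "z \<in> S" "\<And>w. w \<in> S \<Longrightarrow> f w = g w" for f g :: "complex \<Rightarrow> complex" and f' g' z
    using DERIV_unique[OF has_field_derivative_transform_within_open[OF that(1) S that(3,4)] that(2)] .
  have r0: "Digamma z - Digamma (1 - z) = - of_real pi * cos (of_real pi * z) / sin (of_real pi * z)"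
    if z: "z \<in> S" for z :: complex
  proof -
    have L: "((\<lambda>z. Gamma z * Gamma (1 - z)) has_field_derivative
        Gamma z * Digamma z * Gamma (1 - z) - Gamma z * (Gamma (1 - z) * Digamma (1 - z))) (at z)"
      using nonpos[OF z] by (auto intro!: derivative_eq_intros)
    have R: "((\<lambda>z. of_real pi / sin (of_real pi * z)) has_field_derivative
        - (of_real pi * (of_real pi * cos (of_real pi * z))) / (sin (of_real pi * z))\<^sup>2) (at z)"
      using sin_nz[OF z] by (auto intro!: derivative_eq_intros simp: power2_eq_square)
    have "of_real pi / sin (of_real pi * z) * (Digamma z - Digamma (1 - z))
        = - (of_real pi * (of_real pi * cos (of_real pi * z))) / (sin (of_real pi * z))\<^sup>2"
      using deriv_eq[OF L R z Gamma_reflection_complex]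
      unfolding Gamma_reflection_complex[symmetric] by (simp add: algebra_simps)
    \<comment> \<open>Cancels the common factor pi / sin (pi z), which is
      \<open>Gamma z * Gamma (1 - z)\<close>.\<close>
    moreover have "d = - p * c / s" if "p / s * d = - (p * (p * c)) / s\<^sup>2" "s \<noteq> 0" "p \<noteq> 0" for p s c d :: complex
    proof -
      have "d = (p / s * d) * (s / p)" using that(2,3) by simp
      also have "\<dots> = - p * c / s" unfolding that(1) using that(2,3) by (simp add: power2_eq_square)
      finally show ?thesis .
    qed
    ultimately show ?thesis
      using sin_nz[OF z] by (metis of_real_eq_0_iff pi_neq_zero)
  qed
  have sc: "sin (of_real pi * z) ^ 2 = 1 - cos (of_real pi * z) ^ 2" for z :: complex
    by (simp add: sin_squared_eq)
  have r1: "Polygamma 1 z + Polygamma 1 (1 - z) = of_real pi ^ 2 / sin (of_real pi * z) ^ 2"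
    if z: "z \<in> S" for z :: complex
  proof -
    have L: "((\<lambda>z. Digamma z - Digamma (1 - z)) has_field_derivative Polygamma 1 z + Polygamma 1 (1 - z)) (at z)"
      using nonpos[OF z] by (auto intro!: derivative_eq_intros)
    have "((\<lambda>z. - of_real pi * cos (of_real pi * z) / sin (of_real pi * z)) has_field_derivative
        of_real pi ^ 2 / sin (of_real pi * z) ^ 2) (at z)"
      by (rule derivative_eq_intros refl sin_nz[OF z])+
         (use sin_nz[OF z] sc[of z] in \<open>simp add: divide_simps\<close>, simp only: power2_eq_square, algebra)
    from deriv_eq[OF L this z r0] show ?thesis .
  qed
  have r2: "Polygamma 2 z - Polygamma 2 (1 - z)
      = - 2 * of_real pi ^ 3 * cos (of_real pi * z) / sin (of_real pi * z) ^ 3"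
    if z: "z \<in> S" for z :: complex
  proof -
    have L: "((\<lambda>z. Polygamma 1 z + Polygamma 1 (1 - z)) has_field_derivative Polygamma 2 z - Polygamma 2 (1 - z)) (at z)"
      using nonpos[OF z] by (auto intro!: derivative_eq_intros simp: eval_nat_numeral)
    have "((\<lambda>z. of_real pi ^ 2 / sin (of_real pi * z) ^ 2) has_field_derivative
        - 2 * of_real pi ^ 3 * cos (of_real pi * z) / sin (of_real pi * z) ^ 3) (at z)"
      by (rule derivative_eq_intros refl sin_nz[OF z] power_not_zero)+
         (use sin_nz[OF z] in \<open>simp add: divide_simps\<close>, simp add: eval_nat_numeral)
    from deriv_eq[OF L this z r1] show ?thesis .
  qed
  have r3: "Polygamma 3 z + Polygamma 3 (1 - z)
      = 2 * of_real pi ^ 4 * (sin (of_real pi * z) ^ 2 + 3 * cos (of_real pi * z) ^ 2) / sin (of_real pi * z) ^ 4"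
    if z: "z \<in> S" for z :: complex
  proof -
    have L: "((\<lambda>z. Polygamma 2 z - Polygamma 2 (1 - z)) has_field_derivative Polygamma 3 z + Polygamma 3 (1 - z)) (at z)"
      using nonpos[OF z] by (auto intro!: derivative_eq_intros simp: eval_nat_numeral)
    have "((\<lambda>z. - 2 * of_real pi ^ 3 * cos (of_real pi * z) / sin (of_real pi * z) ^ 3) has_field_derivative
        2 * of_real pi ^ 4 * (sin (of_real pi * z) ^ 2 + 3 * cos (of_real pi * z) ^ 2) / sin (of_real pi * z) ^ 4) (at z)"
      by (rule derivative_eq_intros refl sin_nz[OF z] power_not_zero)+
         (use sin_nz[OF z] in \<open>simp add: divide_simps\<close>, simp add: eval_nat_numeral algebra_simps)
    from deriv_eq[OF L this z r2] show ?thesis .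
  qed
  \<comment> \<open>At 1/2 the two Polygamma terms coincide, the sine is 1 and the cosine 0. The
    series of \<open>Polygamma 3\<close> carries the factor 3! = 6, and clearing the halves gives
    2^4 = 16, whence 96 = 6 * 16.\<close>
  have "Polygamma 3 (1 / 2 :: complex) = of_real (pi ^ 4)"
    using r3[of "1 / 2"] by (simp add: S_def sin_of_real cos_of_real)
  then have "(\<lambda>k. inverse ((1 / 2 + of_nat k) ^ 4)) sums (of_real (pi ^ 4 / 6) :: complex)"
    using Polygamma_LIMSEQ[of "1 / 2 :: complex" 3] by (simp add: fact_numeral)
  then have "(\<lambda>k. complex_of_real (inverse ((1 / 2 + real k) ^ 4))) sums of_real (pi ^ 4 / 6)"
    by simp
  then have "(\<lambda>k. inverse ((1 / 2 + real k) ^ 4)) sums (pi ^ 4 / 6)"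
    by (simp only: sums_of_real_iff)
  then have "(\<lambda>k. inverse ((1 / 2 + real k) ^ 4) / 16) sums (pi ^ 4 / 6 / 16)"
    by (rule sums_divide)
  moreover have "inverse ((1 / 2 + real k) ^ 4) / 16 = 1 / (2 * real k + 1) ^ 4" for k
  proof -
    have "(2 * real k + 1) ^ 4 = (2 * (1 / 2 + real k)) ^ 4" by (simp add: algebra_simps)
    then show ?thesis by (simp only: power_mult_distrib) (simp add: divide_simps)
  qed
  ultimately show ?thesis by simp
qed

text \<open>Pairing consecutive terms, the odd denominators contribute pi^4/96 and the even ones
  \<open>Z / 16\<close>, which is a linear equation for \<open>Z\<close>.\<close>

lemma inverse_fourth_powers_sums: "(\<lambda>n. 1 / real (Suc n) ^ 4) sums (pi ^ 4 / 90)"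
proof -
  define Z where "Z = (\<Sum>n. 1 / real (Suc n) ^ 4)"
  have "summable (\<lambda>n. 1 / real (Suc n) ^ 4)"
    using inverse_power_summable[of 4, where 'a = real] by (subst summable_Suc_iff) (simp add: inverse_eq_divide)
  then have Z: "(\<lambda>n. 1 / real (Suc n) ^ 4) sums Z" by (simp add: Z_def summable_sums)
  then have "(\<lambda>n. \<Sum>k = n * 2..<n * 2 + 2. 1 / real (Suc k) ^ 4) sums Z"
    by (rule sums_group) simp
  also have "(\<lambda>n. \<Sum>k = n * 2..<n * 2 + 2. 1 / real (Suc k) ^ 4)
      = (\<lambda>n. 1 / (2 * real n + 1) ^ 4 + 1 / real (Suc n) ^ 4 / 16)"
  proof
    fix n
    have "{n * 2..<n * 2 + 2} = {2 * n, Suc (2 * n)}" by auto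
    moreover have "real (Suc (Suc (2 * n))) ^ 4 = (2 * real (Suc n)) ^ 4" by simp
    ultimately show "(\<Sum>k = n * 2..<n * 2 + 2. 1 / real (Suc k) ^ 4)
        = 1 / (2 * real n + 1) ^ 4 + 1 / real (Suc n) ^ 4 / 16"
      by (simp add: power_mult_distrib del: of_nat_Suc) (simp add: add.commute)
  qed
  finally have "(\<lambda>n. 1 / (2 * real n + 1) ^ 4 + 1 / real (Suc n) ^ 4 / 16) sums Z" .
  moreover have "(\<lambda>n. 1 / (2 * real n + 1) ^ 4 + 1 / real (Suc n) ^ 4 / 16) sums (pi ^ 4 / 96 + Z / 16)"
    by (intro sums_add sums_divide odd_inverse_fourth_powers_sums Z)
  ultimately have "Z = pi ^ 4 / 96 + Z / 16" by (rule sums_unique2)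
  then have "Z = pi ^ 4 / 90" by simp
  from Z[unfolded this] show ?thesis .
qed

section \<open>Rogosinski's theorem\<close>

text \<open>Cauchy's formula for the k-th Taylor coefficient, with the circle of radius
  \<open>r\<close> parametrised by the angle.\<close>

lemma circle_coefficient_has_integral:
  assumes F: "F holomorphic_on ball 0 1" and r: "0 < r" "r < 1"
  shows "((\<lambda>t. F (of_real r * cis t) * cis (- (real k * t))) has_integral
           2 * of_real pi * fps_nth (fps_expansion F 0) k * of_real r ^ k) {0..2 * pi}"
proof -
  have "cball 0 r \<subseteq> (ball 0 1 :: complex set)" using r by auto
  then have "continuous_on (cball 0 r) F" "F holomorphic_on ball 0 r"
    using F by (meson holomorphic_on_imp_continuous_on holomorphic_on_subset ball_subset_cball order_trans)+
  then have "((\<lambda>u. F u / (u - 0) ^ Suc k) has_contour_integral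
               (2 * pi * \<i>) / fact k * (deriv ^^ k) F 0) (part_circlepath 0 r 0 (2 * pi))"
    using Cauchy_has_contour_integral_higher_derivative_circlepath[of 0 r F 0 k] r
    by (simp add: circlepath_def)
  then have "((\<lambda>t. F (of_real r * cis t) / (of_real r * cis t) ^ Suc k * r * \<i> * cis t) has_integral
               (2 * pi * \<i>) / fact k * (deriv ^^ k) F 0) {0..2 * pi}"
    by (subst (asm) has_contour_integral_part_circlepath_iff) auto
  \<comment> \<open>This factor cancels the \<open>\<i>\<close> of the line element and the modulus
    of the k-th power, leaving only its phase.\<close>
  from has_integral_mult_right[OF this, of "- \<i> * of_real r ^ k"]
  show ?thesis
  proof (rule has_integral_eq_rhs[OF has_integral_eq, rotated])
    show "- \<i> * of_real r ^ k * (F (of_real r * cis t) / (of_real r * cis t) ^ Suc k * r * \<i> * cis t)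
        = F (of_real r * cis t) * cis (- (real k * t))" for t
    proof -
      have "cis (- (real k * t)) * cis t ^ k = 1"
        by (simp add: Complex.DeMoivre cis_mult)
      then show ?thesis
        using r by (simp add: power_mult_distrib field_simps)
    qed
  qed (simp add: fps_expansion_def mult_ac)
qed

text \<open>Parseval's identity against a polynomial: only finitely many Fourier coefficients enter,
  so it follows by linearity from the coefficient formula.\<close>

lemma circle_inner_product_has_integral:
  assumes F: "F holomorphic_on ball 0 1" and r: "0 < r" "r < 1"
  shows "((\<lambda>t. F (of_real r * cis t) * cnj (\<Sum>k\<le>n. b k * (of_real r * cis t) ^ k)) has_integral
           of_real (2 * pi) * (\<Sum>k\<le>n. fps_nth (fps_expansion F 0) k * cnj (b k) * of_real r ^ (2 * k)))
         {0..2 * pi}"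
proof -
  let ?a = "fps_nth (fps_expansion F 0)" and ?u = "\<lambda>t. of_real r * cis t"
  have "((\<lambda>t. \<Sum>k\<le>n. cnj (b k) * of_real r ^ k * (F (?u t) * cis (- (real k * t))))
      has_integral (\<Sum>k\<le>n. cnj (b k) * of_real r ^ k * (2 * of_real pi * ?a k * of_real r ^ k))) {0..2 * pi}"
    by (intro has_integral_sum has_integral_mult_right circle_coefficient_has_integral assms) simp
  also have "(\<lambda>t. \<Sum>k\<le>n. cnj (b k) * of_real r ^ k * (F (?u t) * cis (- (real k * t))))
      = (\<lambda>t. F (?u t) * cnj (\<Sum>k\<le>n. b k * ?u t ^ k))"
  proof
    fix t
    have "cnj (b k * ?u t ^ k) = cnj (b k) * of_real r ^ k * cis (- (real k * t))" for k
      by (simp only: power_mult_distrib Complex.DeMoivre complex_cnj_mult complex_cnj_power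
            complex_cnj_complex_of_real cis_cnj mult.assoc)
    then show "(\<Sum>k\<le>n. cnj (b k) * of_real r ^ k * (F (?u t) * cis (- (real k * t))))
        = F (?u t) * cnj (\<Sum>k\<le>n. b k * ?u t ^ k)"
      by (simp only: cnj_sum sum_distrib_left mult_ac)
  qed
  also have "(\<Sum>k\<le>n. cnj (b k) * of_real r ^ k * (2 * of_real pi * ?a k * of_real r ^ k))
      = of_real (2 * pi) * (\<Sum>k\<le>n. ?a k * cnj (b k) * of_real r ^ (2 * k))"
  proof -
    have "complex_of_real r ^ (2 * k) = of_real r ^ k * of_real r ^ k" for k
      by (simp add: mult_2 power_add)
    then show ?thesis
      by (simp only: sum_distrib_left of_real_mult of_real_numeral mult_ac)
  qed
  finally show ?thesis .
qed

lemma polynomial_has_fps_expansion: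
  fixes P :: "complex fps"
  assumes "\<And>j. m < j \<Longrightarrow> fps_nth P j = 0"
  shows "(\<lambda>z. \<Sum>j\<le>m. fps_nth P j * z ^ j) has_fps_expansion P"
  using assms by (intro has_fps_expansionI always_eventually allI sums_finite) auto

text \<open>Bessel's inequality on the circle of radius \<open>r\<close>; no integrability of \<open>|\<omega> P|\<^sup>2\<close> is needed because
  \<open>|\<omega> P|\<^sup>2\<close> is eliminated pointwise.\<close>
lemma bounded_multiplier_contraction:
  assumes w: "w holomorphic_on ball 0 1" "\<And>z. z \<in> ball 0 1 \<Longrightarrow> cmod (w z) \<le> 1"
    and P: "\<And>j. m < j \<Longrightarrow> fps_nth P j = 0"
  shows "(\<Sum>k\<le>n. (cmod (fps_nth (fps_expansion w 0 * P) k))\<^sup>2) \<le> (\<Sum>j\<le>m. (cmod (fps_nth P j))\<^sup>2)"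
proof -
  \<comment> \<open>\<open>h\<close> is the polynomial with coefficients \<open>P\<close>,
    \<open>E\<close> the Taylor series of \<open>w * h\<close>, and \<open>s\<close> the section of
    \<open>E\<close> up to degree \<open>n\<close>.\<close>
  define h where "h = (\<lambda>z. \<Sum>j\<le>m. fps_nth P j * z ^ j)"
  define E where "E = fps_expansion w 0 * P"
  define s where "s = (\<lambda>z. \<Sum>k\<le>n. fps_nth E k * z ^ k)"
  have h: "h holomorphic_on ball 0 1" and s: "s holomorphic_on ball 0 1"
    unfolding h_def s_def by (intro holomorphic_intros)+
  have hP: "fps_expansion h 0 = P"
    unfolding h_def by (intro fps_expansion_eqI polynomial_has_fps_expansion P)
  have sE: "fps_expansion s 0 = fps_cutoff (Suc n) E"
    using polynomial_has_fps_expansion[of n "fps_cutoff (Suc n) E"]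
    by (intro fps_expansion_eqI) (simp add: s_def)
  have whE: "fps_expansion (\<lambda>z. w z * h z) 0 = E"
    unfolding E_def h_def
    by (intro fps_expansion_eqI has_fps_expansion_mult polynomial_has_fps_expansion P
          has_fps_expansion_fps_expansion[OF _ _ w(1)]) auto
  have on_circle: "(\<Sum>k\<le>n. (cmod (fps_nth E k))\<^sup>2 * r ^ (2 * k)) \<le> (\<Sum>j\<le>m. (cmod (fps_nth P j))\<^sup>2 * r ^ (2 * j))"
    if r: "0 < r" "r < 1" for r
  proof -
    define A where "A = (\<Sum>k\<le>n. (cmod (fps_nth E k))\<^sup>2 * r ^ (2 * k))"
    define B where "B = (\<Sum>j\<le>m. (cmod (fps_nth P j))\<^sup>2 * r ^ (2 * j))"
    let ?u = "\<lambda>t. of_real r * cis t"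
    have u: "?u t \<in> ball 0 1" for t using r by (simp add: norm_mult)
    have eqs: "(\<Sum>k\<le>n. fps_nth E k * z ^ k) = s z" "(\<Sum>j\<le>m. fps_nth P j * z ^ j) = h z" for z
      by (simp_all add: s_def h_def)
    have A: "(\<Sum>k\<le>n. fps_nth E k * cnj (fps_nth E k) * of_real r ^ (2 * k)) = of_real A"
      and B: "(\<Sum>j\<le>m. fps_nth P j * cnj (fps_nth P j) * of_real r ^ (2 * j)) = of_real B"
      by (simp_all add: A_def B_def flip: complex_norm_square)
    have A': "(\<Sum>k\<le>n. fps_nth (fps_cutoff (Suc n) E) k * cnj (fps_nth E k) * of_real r ^ (2 * k)) = of_real A"
      unfolding A[symmetric] by (intro sum.cong) auto
    have cross: "((\<lambda>t. w (?u t) * h (?u t) * cnj (s (?u t))) has_integral of_real (2 * pi * A)) {0..2*pi}"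
      using circle_inner_product_has_integral[OF holomorphic_on_mult[OF w(1) h] r, of "fps_nth E" n]
      unfolding whE eqs A by simp
    have ss: "((\<lambda>t. s (?u t) * cnj (s (?u t))) has_integral of_real (2 * pi * A)) {0..2*pi}"
      using circle_inner_product_has_integral[OF s r, of "fps_nth E" n]
      unfolding sE eqs A' by simp
    have hh: "((\<lambda>t. h (?u t) * cnj (h (?u t))) has_integral of_real (2 * pi * B)) {0..2*pi}"
      using circle_inner_product_has_integral[OF h r, of "fps_nth P" m]
      unfolding hP eqs B by simp
    \<comment> \<open>Integrated form of 2 Re (w h cnj s) - |s|^2 <= |w h|^2 <= |h|^2, where the
      first inequality is |w h - s|^2 >= 0. Since \<open>s\<close> is a section of
      \<open>w * h\<close>, both \<open>cross\<close> and \<open>ss\<close> have the value 2 pi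
      A.\<close>
    have "2 * (2 * pi * A) - 2 * pi * A \<le> 2 * pi * B"
    proof (rule has_integral_le)
      show "((\<lambda>t. 2 * Re (w (?u t) * h (?u t) * cnj (s (?u t))) - Re (s (?u t) * cnj (s (?u t))))
          has_integral 2 * (2 * pi * A) - 2 * pi * A) {0..2*pi}"
        using has_integral_linear[OF cross bounded_linear_Re] has_integral_linear[OF ss bounded_linear_Re]
        by (intro has_integral_diff has_integral_mult_right) (simp_all add: o_def)
      show "((\<lambda>t. Re (h (?u t) * cnj (h (?u t)))) has_integral 2 * pi * B) {0..2*pi}"
        using has_integral_linear[OF hh bounded_linear_Re] by (simp add: o_def)
      show "2 * Re (w (?u t) * h (?u t) * cnj (s (?u t))) - Re (s (?u t) * cnj (s (?u t)))
          \<le> Re (h (?u t) * cnj (h (?u t)))" for t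
      proof -
        let ?a = "w (?u t) * h (?u t)" and ?b = "s (?u t)"
        have sq: "Re (x * cnj x) = (cmod x)\<^sup>2" for x
          using arg_cong[OF complex_norm_square[of x], of Re] by (simp flip: of_real_power)
        have "0 \<le> (cmod (?a - ?b))\<^sup>2" by simp
        also have "\<dots> = (cmod ?a)\<^sup>2 - 2 * Re (?a * cnj ?b) + (cmod ?b)\<^sup>2"
          unfolding cmod_power2 by (simp add: power2_eq_square algebra_simps)
        finally have "2 * Re (?a * cnj ?b) - (cmod ?b)\<^sup>2 \<le> (cmod ?a)\<^sup>2" by simp
        also have "\<dots> \<le> (cmod (h (?u t)))\<^sup>2"
          using w(2)[OF u[of t]] by (intro power_mono) (auto simp: norm_mult mult_left_le_one_le)
        finally show ?thesis unfolding sq .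
      qed
    qed
    then show ?thesis by (simp add: A_def B_def)
  qed
  \<comment> \<open>Let \<open>r\<close> tend to 1 from below; the right-hand side is bounded by its
    value at 1 throughout.\<close>
  have "((\<lambda>r. \<Sum>k\<le>n. (cmod (fps_nth E k))\<^sup>2 * r ^ (2 * k)) \<longlongrightarrow>
          (\<Sum>k\<le>n. (cmod (fps_nth E k))\<^sup>2 * 1 ^ (2 * k))) (at_left 1)"
    by (intro tendsto_intros)
  moreover have "\<forall>\<^sub>F r in at_left 1. (\<Sum>k\<le>n. (cmod (fps_nth E k))\<^sup>2 * r ^ (2 * k)) \<le> (\<Sum>j\<le>m. (cmod (fps_nth P j))\<^sup>2)"
    using eventually_at_left_real[of 0 1, OF zero_less_one]
  proof eventually_elim
    case (elim r)
    have "(\<Sum>j\<le>m. (cmod (fps_nth P j))\<^sup>2 * r ^ (2 * j)) \<le> (\<Sum>j\<le>m. (cmod (fps_nth P j))\<^sup>2)"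
      using elim by (intro sum_mono mult_left_le power_le_one) auto
    then show ?case using on_circle[of r] elim by auto
  qed
  ultimately have "(\<Sum>k\<le>n. (cmod (fps_nth E k))\<^sup>2 * 1 ^ (2 * k)) \<le> (\<Sum>j\<le>m. (cmod (fps_nth P j))\<^sup>2)"
    by (rule tendsto_upperbound) simp
  then show ?thesis by (simp add: E_def)
qed

text \<open>Splitting off the constant term of \<open>G\<close> leaves \<open>\<omega>\<close> times a composition with the shifted series, and
  multiplication by \<open>\<omega>\<close> raises the order by one while not increasing the norm.\<close>
lemma rogosinski:
  assumes w: "w holomorphic_on ball 0 1" "w 0 = 0" "\<And>z. z \<in> ball 0 1 \<Longrightarrow> cmod (w z) \<le> 1"
  shows "(\<Sum>k\<le>n. (cmod (fps_nth (G oo fps_expansion w 0) k))\<^sup>2) \<le> (\<Sum>k\<le>n. (cmod (fps_nth G k))\<^sup>2)"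
proof (induction n arbitrary: G)
  case 0
  show ?case by simp
next
  case (Suc m)
  define W where "W = fps_expansion w 0"
  define H where "H = fps_shift 1 G oo W"
  have W0: "fps_nth W 0 = 0" using w(2) by (simp add: W_def fps_expansion_def)
  have "G = fps_const (fps_nth G 0) + fps_X * fps_shift 1 G"
    by (auto simp: fps_eq_iff)
  then have "G oo W = (fps_const (fps_nth G 0) + fps_X * fps_shift 1 G) oo W" by simp
  also have "\<dots> = fps_const (fps_nth G 0) + W * H"
    using W0 by (simp add: fps_compose_add_distrib fps_compose_mult_distrib H_def)
  finally have GW: "G oo W = fps_const (fps_nth G 0) + W * H" .
  \<comment> \<open>As \<open>W\<close> has no constant term, the k-th coefficient of
    \<open>W * H\<close> involves only coefficients of \<open>H\<close> below k. So \<open>H\<close>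
    may be truncated to a polynomial of degree at most \<open>m\<close>, as the contraction lemma
    requires.\<close>
  have cut: "fps_nth (W * H) k = fps_nth (W * fps_cutoff (Suc m) H) k" if "k \<le> Suc m" for k
    unfolding fps_mult_nth
  proof (intro sum.cong refl)
    fix i assume "i \<in> {0..k}"
    then show "fps_nth W i * fps_nth H (k - i) = fps_nth W i * fps_nth (fps_cutoff (Suc m) H) (k - i)"
      using W0 that by (cases "i = 0") auto
  qed
  have "(\<Sum>k\<le>Suc m. (cmod (fps_nth (G oo W) k))\<^sup>2)
      = (cmod (fps_nth G 0))\<^sup>2 + (\<Sum>k\<le>m. (cmod (fps_nth (W * H) (Suc k)))\<^sup>2)"
    unfolding GW using W0 by (subst sum.atMost_Suc_shift) (simp del: sum.atMost_Suc)
  also have "(\<Sum>k\<le>m. (cmod (fps_nth (W * H) (Suc k)))\<^sup>2) \<le> (\<Sum>k\<le>Suc m. (cmod (fps_nth (W * H) k))\<^sup>2)"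
    by (subst sum.atMost_Suc_shift) simp
  also have "\<dots> = (\<Sum>k\<le>Suc m. (cmod (fps_nth (W * fps_cutoff (Suc m) H) k))\<^sup>2)"
    by (intro sum.cong refl) (simp add: cut)
  also have "\<dots> \<le> (\<Sum>j\<le>m. (cmod (fps_nth (fps_cutoff (Suc m) H) j))\<^sup>2)"
    unfolding W_def by (intro bounded_multiplier_contraction w) auto
  also have "\<dots> = (\<Sum>j\<le>m. (cmod (fps_nth H j))\<^sup>2)"
    by (intro sum.cong) auto
  \<comment> \<open>The induction is over all \<open>G\<close>, so its hypothesis covers the shifted
    series.\<close>
  also have "\<dots> \<le> (\<Sum>j\<le>m. (cmod (fps_nth (fps_shift 1 G) j))\<^sup>2)"
    unfolding H_def W_def by (rule Suc.IH)
  also have "(cmod (fps_nth G 0))\<^sup>2 + \<dots> = (\<Sum>k\<le>Suc m. (cmod (fps_nth G k))\<^sup>2)"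
    by (subst sum.atMost_Suc_shift) simp
  finally show ?case by (simp add: W_def)
qed

text \<open>Summation by parts in inductive form: the weighted sum of the differences is at least
  the last weight times their plain sum, which is nonnegative.\<close>

lemma weighted_sum_mono:
  fixes a b w :: "nat \<Rightarrow> real"
  assumes "\<And>n. (\<Sum>k\<le>n. a k) \<le> (\<Sum>k\<le>n. b k)" "antimono w" "\<And>n. 0 \<le> w n"
  shows "(\<Sum>k\<le>n. a k * w k) \<le> (\<Sum>k\<le>n. b k * w k)"
proof -
  have "w n * (\<Sum>k\<le>n. b k - a k) \<le> (\<Sum>k\<le>n. (b k - a k) * w k)"
  proof (induction n)
    case (Suc n)
    have "w (Suc n) * (\<Sum>k\<le>n. b k - a k) \<le> w n * (\<Sum>k\<le>n. b k - a k)"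
      using assms(1)[of n] antimonoD[OF assms(2), of n "Suc n"]
      by (intro mult_right_mono) (auto simp: sum_subtractf)
    with Suc show ?case by (simp add: algebra_simps)
  qed simp
  moreover have "0 \<le> w n * (\<Sum>k\<le>n. b k - a k)"
    using assms(1)[of n] assms(3)[of n] by (simp add: sum_subtractf)
  ultimately show ?thesis by (simp add: left_diff_distrib sum_subtractf)
qed

section \<open>The conformal map onto a strip\<close>

text \<open>Maps the disc onto the horizontal strip \<open>\<phi> - \<pi> < Im w < \<phi>\<close>; the paper's strip is obtained with
  \<open>\<phi> = \<pi> (1 - \<alpha>)/(\<beta> - \<alpha>)\<close> after multiplication by \<open>i (\<beta> - \<alpha>)/\<pi>\<close>.\<close>
definition half_plane_log :: "real \<Rightarrow> complex \<Rightarrow> complex" where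
  "half_plane_log \<phi> z = Ln (1 - cis (2 * \<phi>) * z) - Ln (1 - z)"

text \<open>Keeps both arguments of \<open>Ln\<close> in the right half-plane, where the principal
  branch is analytic with imaginary part of modulus below pi/2.\<close>

lemma half_plane_log_arguments:
  assumes "cmod z < 1"
  shows "0 < Re (1 - cis (2 * \<phi>) * z) \<and> 0 < Re (1 - z)"
proof -
  have "Re (cis (2 * \<phi>) * z) \<le> cmod (cis (2 * \<phi>) * z)" by (rule complex_Re_le_cmod)
  then show ?thesis using assms complex_Re_le_cmod[of z] by (simp add: norm_mult)
qed

lemma holomorphic_half_plane_log: "half_plane_log \<phi> holomorphic_on ball 0 1"
proof -
  have "1 - cis (2 * \<phi>) * z \<notin> \<real>\<^sub>\<le>\<^sub>0" "1 - z \<notin> \<real>\<^sub>\<le>\<^sub>0" if "z \<in> ball 0 1" for z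
    using half_plane_log_arguments[of z \<phi>] that by (auto simp: complex_nonpos_Reals_iff)
  then show ?thesis
    unfolding half_plane_log_def by (intro holomorphic_intros) auto
qed

text \<open>Difference of two logarithmic series. The term at \<open>n = 0\<close> is 0/0 = 0, so
  the sum may start there.\<close>

lemma half_plane_log_sums:
  assumes "cmod z < 1"
  shows "(\<lambda>n. (1 - cis (2 * \<phi>) ^ n) / of_nat n * z ^ n) sums half_plane_log \<phi> z"
proof -
  have L: "(\<lambda>n. w ^ n / of_nat n) sums - Ln (1 - w)" if "cmod w < 1" for w :: complex
    using sums_minus[OF Ln_series[of "-w"]] that by (simp add: power_minus')
  have "(\<lambda>n. z ^ n / of_nat n - (cis (2 * \<phi>) * z) ^ n / of_nat n) sums
      (- Ln (1 - z) - - Ln (1 - cis (2 * \<phi>) * z))"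
    using assms by (intro sums_diff L) (auto simp: norm_mult)
  then show ?thesis
    by (simp add: half_plane_log_def power_mult_distrib diff_divide_distrib left_diff_distrib)
qed

lemma half_plane_log_has_fps_expansion:
  "half_plane_log \<phi> has_fps_expansion Abs_fps (\<lambda>n. (1 - cis (2 * \<phi>) ^ n) / of_nat n)"
proof -
  have "(\<lambda>n. fps_nth (Abs_fps (\<lambda>n. (1 - cis (2 * \<phi>) ^ n) / of_nat n)) n * z ^ n) sums half_plane_log \<phi> z"
    if "z \<in> ball 0 1" for z
    using half_plane_log_sums[of z \<phi>] that by simp
  then show ?thesis
    by (intro has_fps_expansionI eventually_nhds_in_open[of "ball 0 1", THEN eventually_mono]) auto
qed

lemma exp_half_plane_log:
  assumes "cmod z < 1"
  shows "exp (half_plane_log \<phi> z) = (1 - cis (2 * \<phi>) * z) / (1 - z)"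
proof -
  have "1 - cis (2 * \<phi>) * z \<noteq> 0" "1 - z \<noteq> 0"
    using half_plane_log_arguments[OF assms, of \<phi>] by force+
  then show ?thesis by (simp add: half_plane_log_def exp_diff)
qed

text \<open>Fixes the branch: within this range \<open>Ln\<close> undoes \<open>exp\<close>.\<close>

lemma Im_half_plane_log_bound:
  assumes "cmod z < 1"
  shows "\<bar>Im (half_plane_log \<phi> z)\<bar> < pi"
proof -
  have "\<bar>Im (Ln (1 - cis (2 * \<phi>) * z))\<bar> < pi / 2" "\<bar>Im (Ln (1 - z))\<bar> < pi / 2"
    using half_plane_log_arguments[OF assms, of \<phi>] by (intro Re_Ln_pos_lt_imp; simp)+
  then show ?thesis by (simp add: half_plane_log_def)
qed

text \<open>The perpendicular bisector of \<open>1\<close> and \<open>cis (2 \<phi>)\<close> is the line through \<open>0\<close> and \<open>cis \<phi>\<close>.\<close>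
lemma closer_to_one_iff:
  assumes "0 < \<phi>" "\<phi> < pi"
  shows "cmod (v - 1) < cmod (v - cis (2 * \<phi>)) \<longleftrightarrow> Im (v * cis (- \<phi>)) < 0"
proof -
  have "(cmod (v - 1))\<^sup>2 - (cmod (v - cis (2 * \<phi>)))\<^sup>2 = 4 * sin \<phi> * Im (v * cis (- \<phi>))" (is "?a\<^sup>2 - ?b\<^sup>2 = _")
  proof -
    have "(cos (2 * \<phi>))\<^sup>2 + (sin (2 * \<phi>))\<^sup>2 = 1" by simp
    then have "(cmod (v - 1))\<^sup>2 - (cmod (v - cis (2 * \<phi>)))\<^sup>2
        = 2 * Re v * (cos (2 * \<phi>) - 1) + 2 * Im v * sin (2 * \<phi>)"
      unfolding cmod_power2 by (simp add: power2_eq_square algebra_simps)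
    also have "\<dots> = 4 * sin \<phi> * Im (v * cis (- \<phi>))"
      unfolding cos_double_sin sin_double by (simp add: power2_eq_square algebra_simps)
    finally show ?thesis .
  qed
  moreover have "?a < ?b \<longleftrightarrow> ?a\<^sup>2 - ?b\<^sup>2 < 0"
    by (simp add: power_mono_iff flip: not_le)
  ultimately show ?thesis
    using sin_gt_zero[OF assms] by (simp add: mult_less_0_iff)
qed

lemma Im_exp_rotated: "Im (exp s * cis (- \<phi>)) = exp (Re s) * sin (Im s - \<phi>)"
  by (simp add: Im_exp Re_exp sin_diff algebra_simps)

text \<open>The Moebius map z -> (1 - c z)/(1 - z) with c = \<open>cis (2 * \<phi>)\<close> sends
  the disc into the half-plane of points closer to 1 than to c. For the logarithm this means sin (Im
  s - \<phi>) < 0, and |Im s| < pi singles out one strip among its translates by 2 pi.\<close>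

lemma half_plane_log_in_strip:
  assumes \<phi>: "0 < \<phi>" "\<phi> < pi" and z: "cmod z < 1"
  shows "\<phi> - pi < Im (half_plane_log \<phi> z) \<and> Im (half_plane_log \<phi> z) < \<phi>"
proof -
  define s where "s = half_plane_log \<phi> z"
  have nz: "1 - z \<noteq> 0" using half_plane_log_arguments[OF z, of 0] by force
  have c1: "cis (2 * \<phi>) \<noteq> 1"
  proof
    assume "cis (2 * \<phi>) = 1"
    then have "1 - 2 * (sin \<phi>)\<^sup>2 = 1" by (simp add: complex_eq_iff cos_double_sin)
    then show False using sin_gt_zero[OF \<phi>] by simp
  qed
  have s: "exp s = (1 - cis (2 * \<phi>) * z) / (1 - z)"
    unfolding s_def by (rule exp_half_plane_log[OF z])
  have "exp s - 1 = z * (1 - cis (2 * \<phi>)) / (1 - z)" "exp s - cis (2 * \<phi>) = (1 - cis (2 * \<phi>)) / (1 - z)"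
    unfolding s using nz by (simp_all add: field_simps)
  then have "cmod (exp s - 1) < cmod (exp s - cis (2 * \<phi>))"
    using z nz c1 by (simp add: norm_mult norm_divide divide_strict_right_mono)
  then have "sin (Im s - \<phi>) < 0"
    unfolding closer_to_one_iff[OF \<phi>] Im_exp_rotated by (simp add: mult_less_0_iff)
  moreover have "0 \<le> sin (Im s - \<phi>)" if "\<phi> \<le> Im s"
    using that \<phi> Im_half_plane_log_bound[OF z, of \<phi>] by (intro sin_ge_zero) (auto simp: s_def)
  \<comment> \<open>Here -2 pi < Im s - \<phi> <= -pi, so one period moves the argument into the
    interval from 0 to pi.\<close>
  moreover have "0 \<le> sin (Im s - \<phi>)" if "Im s \<le> \<phi> - pi"
  proof -
    have "0 \<le> sin (Im s - \<phi> + 2 * pi)"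
      using that \<phi> Im_half_plane_log_bound[OF z, of \<phi>] by (intro sin_ge_zero) (auto simp: s_def)
    then show ?thesis by (simp only: sin_periodic)
  qed
  ultimately show ?thesis unfolding s_def by force
qed

text \<open>Solving u = (1 - c w)/(1 - w) for w, with u = exp (g z) and c =
  \<open>cis (2 * \<phi>)\<close>, gives w = (u - 1)/(u - c). The strip condition says that u is
  closer to 1 than to c, hence |w| < 1.\<close>

lemma subordinate_to_half_plane_log:
  assumes \<phi>: "0 < \<phi>" "\<phi> < pi" and g: "g holomorphic_on ball 0 1" "g 0 = 0"
    and strip: "\<And>z. z \<in> ball 0 1 \<Longrightarrow> \<phi> - pi < Im (g z) \<and> Im (g z) < \<phi>"
  obtains w where "w holomorphic_on ball 0 1" "w 0 = 0" "\<And>z. z \<in> ball 0 1 \<Longrightarrow> cmod (w z) < 1"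
    "\<And>z. z \<in> ball 0 1 \<Longrightarrow> half_plane_log \<phi> (w z) = g z"
proof
  let ?c = "cis (2 * \<phi>)"
  define w where "w = (\<lambda>z. (exp (g z) - 1) / (exp (g z) - ?c))"
  have closer: "cmod (exp (g z) - 1) < cmod (exp (g z) - ?c)" if "z \<in> ball 0 1" for z
  proof -
    have "0 < sin (\<phi> - Im (g z))"
      using strip[OF that] by (intro sin_gt_zero) auto
    then have "sin (Im (g z) - \<phi>) < 0"
      using sin_minus[of "\<phi> - Im (g z)"] by simp
    then show ?thesis
      unfolding closer_to_one_iff[OF \<phi>] Im_exp_rotated by (simp add: mult_less_0_iff)
  qed
  then have nz: "exp (g z) - ?c \<noteq> 0" if "z \<in> ball 0 1" for z
    using that by force
  show "w holomorphic_on ball 0 1"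
    unfolding w_def using nz by (intro holomorphic_intros g) auto
  show "w 0 = 0" by (simp add: w_def g)
  show w1: "cmod (w z) < 1" if "z \<in> ball 0 1" for z
    using closer[OF that] nz[OF that] by (simp add: w_def norm_divide)
  show "half_plane_log \<phi> (w z) = g z" if z: "z \<in> ball 0 1" for z
  proof -
    let ?u = "exp (g z)"
    have "?c \<noteq> 1" using closer[OF z] by auto
    moreover have "1 - w z = (1 - ?c) / (?u - ?c)" "1 - ?c * w z = ?u * (1 - ?c) / (?u - ?c)"
      using nz[OF z] by (simp_all add: w_def divide_simps) (simp add: algebra_simps)
    ultimately have eq: "exp (half_plane_log \<phi> (w z)) = ?u"
      using nz[OF z] exp_half_plane_log[OF w1[OF z], of \<phi>] by simp
    \<comment> \<open>Both functions have imaginary part strictly between -pi and pi, so equal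
      exponentials force equal values.\<close>
    have "half_plane_log \<phi> (w z) = Ln (exp (half_plane_log \<phi> (w z)))"
      using Im_half_plane_log_bound[OF w1[OF z], of \<phi>] by (intro Ln_exp[symmetric]) auto
    also have "\<dots> = Ln ?u" by (simp only: eq)
    also have "\<dots> = g z"
      using strip[OF z] \<phi> by (intro Ln_exp) auto
    finally show ?thesis .
  qed
qed

text \<open>Subordination makes the series of \<open>g\<close> a composition of the series of
  \<open>half_plane_log \<phi>\<close> with that of \<open>w\<close>, to which Rogosinski's theorem
  applies.\<close>

lemma strip_coefficients_bound:
  assumes \<phi>: "0 < \<phi>" "\<phi> < pi" and g: "g holomorphic_on ball 0 1" "g 0 = 0"
    and strip: "\<And>z. z \<in> ball 0 1 \<Longrightarrow> \<phi> - pi < Im (g z) \<and> Im (g z) < \<phi>"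
  shows "(\<Sum>k\<le>n. (cmod (fps_nth (fps_expansion g 0) k))\<^sup>2)
    \<le> (\<Sum>k\<le>n. (cmod ((1 - cis (2 * \<phi>) ^ k) / of_nat k))\<^sup>2)"
proof -
  obtain w where w: "w holomorphic_on ball 0 1" "w 0 = 0" "\<And>z. z \<in> ball 0 1 \<Longrightarrow> cmod (w z) < 1"
    "\<And>z. z \<in> ball 0 1 \<Longrightarrow> half_plane_log \<phi> (w z) = g z"
    using subordinate_to_half_plane_log[OF assms] by metis
  define B where "B = Abs_fps (\<lambda>n. (1 - cis (2 * \<phi>) ^ n) / of_nat n)"
  have "w has_fps_expansion fps_expansion w 0"
    using has_fps_expansion_fps_expansion[OF _ _ w(1)] by simp
  then have "(half_plane_log \<phi> \<circ> w) has_fps_expansion (B oo fps_expansion w 0)"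
    unfolding B_def using w(2)
    by (intro has_fps_expansion_compose half_plane_log_has_fps_expansion) (auto simp: fps_expansion_def)
  moreover have "\<forall>\<^sub>F z in nhds 0. (half_plane_log \<phi> \<circ> w) z = g z"
    using w(4) by (intro eventually_nhds_in_open[of "ball 0 1", THEN eventually_mono]) auto
  ultimately have "g has_fps_expansion (B oo fps_expansion w 0)"
    by (subst (asm) has_fps_expansion_cong) auto
  then have "fps_expansion g 0 = B oo fps_expansion w 0"
    by (rule fps_expansion_eqI)
  then show ?thesis
    using rogosinski[OF w(1,2) less_imp_le[OF w(3)], where n = n and G = B] by (simp add: B_def)
qed

section \<open>The extremal series in terms of Li4, and weighted coefficient sums\<close>

lemma Li4_sums:
  assumes "cmod z \<le> 1"
  shows "(\<lambda>n. z ^ Suc n / of_nat (Suc n) ^ 4) sums Li4 z"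
proof -
  have "summable (\<lambda>n. norm (z ^ Suc n / of_nat (Suc n) ^ 4))"
  proof (rule summable_comparison_test'[OF sums_summable[OF inverse_fourth_powers_sums]])
    show "norm (norm (z ^ Suc n / of_nat (Suc n) ^ 4)) \<le> 1 / real (Suc n) ^ 4" for n
    proof -
      have "cmod z ^ Suc n \<le> 1" using assms by (intro power_le_one) auto
      then show ?thesis
        by (simp add: norm_divide norm_power norm_mult divide_right_mono del: of_nat_Suc power_Suc)
    qed
  qed
  then show ?thesis
    unfolding Li4_def by (intro summable_sums) (rule summable_norm_cancel)
qed

text \<open>On the unit circle |1 - c^n|^2 = 2 - c^n - c^(-n). Dividing by n^4 and summing yields 2
  zeta(4) = pi^4/45 and the two values of \<open>Li4\<close>.\<close>

lemma extremal_sums: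
  "(\<lambda>n. complex_of_real ((cmod ((1 - cis t ^ Suc n) / of_nat (Suc n)))\<^sup>2 / (real (Suc n))\<^sup>2)) sums
    (of_real (pi ^ 4 / 45) - Li4 (cis (- t)) - Li4 (cis t))"
proof -
  have "(\<lambda>n. complex_of_real (2 * (1 / real (Suc n) ^ 4))) sums of_real (2 * (pi ^ 4 / 90))"
    by (intro sums_of_real sums_mult inverse_fourth_powers_sums)
  then have "(\<lambda>n. complex_of_real (2 * (1 / real (Suc n) ^ 4)) - cis (- t) ^ Suc n / of_nat (Suc n) ^ 4
      - cis t ^ Suc n / of_nat (Suc n) ^ 4) sums
      (of_real (2 * (pi ^ 4 / 90)) - Li4 (cis (- t)) - Li4 (cis t))"
    by (intro sums_diff Li4_sums) auto
  moreover have "complex_of_real (2 * (1 / real (Suc n) ^ 4)) - cis (- t) ^ Suc n / of_nat (Suc n) ^ 4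
      - cis t ^ Suc n / of_nat (Suc n) ^ 4
      = complex_of_real ((cmod ((1 - cis t ^ Suc n) / of_nat (Suc n)))\<^sup>2 / (real (Suc n))\<^sup>2)" for n
  proof -
    let ?d = "cis t ^ Suc n"
    have d: "?d * cis (- t) ^ Suc n = 1"
      by (simp add: cis_mult del: power_Suc flip: power_mult_distrib)
    have "complex_of_real ((cmod (1 - ?d))\<^sup>2) = (1 - ?d) * (1 - cis (- t) ^ Suc n)"
      by (simp only: complex_norm_square complex_cnj_diff complex_cnj_one complex_cnj_power cis_cnj)
    also have "\<dots> = 2 - ?d - cis (- t) ^ Suc n"
      unfolding ring_distribs left_diff_distrib right_diff_distrib d by simp
    finally have "complex_of_real ((cmod (1 - ?d))\<^sup>2) = 2 - ?d - cis (- t) ^ Suc n" .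
    moreover have "(cmod ((1 - ?d) / of_nat (Suc n)))\<^sup>2 / (real (Suc n))\<^sup>2 = (cmod (1 - ?d))\<^sup>2 / real (Suc n) ^ 4"
      by (simp add: norm_divide power_divide del: of_nat_Suc power_Suc flip: power_add)
    ultimately show ?thesis
      by (simp add: diff_divide_distrib del: of_nat_Suc power_Suc)
  qed
  ultimately show ?thesis by simp
qed

text \<open>The weights 1/n^2 decrease, so the bounds on sections pass to the weighted partial sums;
  their uniform bound \<open>S\<close> also gives convergence.\<close>

lemma strip_weighted_sum_bound:
  assumes \<phi>: "0 < \<phi>" "\<phi> < pi" and g: "g holomorphic_on ball 0 1" "g 0 = 0"
    and strip: "\<And>z. z \<in> ball 0 1 \<Longrightarrow> \<phi> - pi < Im (g z) \<and> Im (g z) < \<phi>"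
    and S: "(\<lambda>n. (cmod ((1 - cis (2 * \<phi>) ^ Suc n) / of_nat (Suc n)))\<^sup>2 / (real (Suc n))\<^sup>2) sums S"
  defines "a \<equiv> \<lambda>n. (cmod (fps_nth (fps_expansion g 0) (Suc n)))\<^sup>2 / (real (Suc n))\<^sup>2"
  shows "summable a \<and> suminf a \<le> S"
proof -
  let ?b = "\<lambda>k. (cmod ((1 - cis (2 * \<phi>) ^ k) / of_nat k))\<^sup>2"
  let ?c = "\<lambda>k. (cmod (fps_nth (fps_expansion g 0) k))\<^sup>2"
  have g0: "?c 0 = 0" using g(2) by (simp add: fps_expansion_def)
  \<comment> \<open>Both \<open>?c\<close> and \<open>?b\<close> vanish at index 0, the latter
    because its numerator is 1 - 1, so the comparison may start at index 1.\<close>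
  have drop: "(\<Sum>k\<le>n. c (Suc k)) \<le> (\<Sum>k\<le>n. d (Suc k))"
    if "(\<Sum>k\<le>Suc n. c k) \<le> (\<Sum>k\<le>Suc n. d k)" "c 0 = 0" "d 0 = 0" for c d :: "nat \<Rightarrow> real" and n
    using that unfolding sum.atMost_Suc_shift by simp
  have partial: "(\<Sum>k\<le>n. a k) \<le> (\<Sum>k\<le>n. ?b (Suc k) / (real (Suc k))\<^sup>2)" for n
  proof -
    have "(\<Sum>k\<le>n. ?c (Suc k) * (1 / (real (Suc k))\<^sup>2)) \<le> (\<Sum>k\<le>n. ?b (Suc k) * (1 / (real (Suc k))\<^sup>2))"
    proof (rule weighted_sum_mono)
      show "(\<Sum>k\<le>m. ?c (Suc k)) \<le> (\<Sum>k\<le>m. ?b (Suc k))" for m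
        by (rule drop[OF strip_coefficients_bound[OF \<phi> g strip] g0]) auto
      show "antimono (\<lambda>k. 1 / (real (Suc k))\<^sup>2)"
        by (intro antimonoI divide_left_mono power_mono) auto
    qed simp
    then show ?thesis by (simp add: a_def del: of_nat_Suc power_Suc)
  qed
  have le: "(\<Sum>k<n. a k) \<le> S" for n
  proof -
    have "(\<Sum>k<n. a k) \<le> (\<Sum>k\<le>n. a k)" by (intro sum_mono2) (auto simp: a_def)
    also note partial[of n]
    also have "(\<Sum>k\<le>n. ?b (Suc k) / (real (Suc k))\<^sup>2) \<le> (\<Sum>k. ?b (Suc k) / (real (Suc k))\<^sup>2)"
      using S by (intro sum_le_suminf) (auto simp: sums_iff)
    also have "\<dots> = S" using S by (rule sums_unique[symmetric])
    finally show ?thesis .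
  qed
  have "(\<Sum>k\<le>n. a k) \<le> S" for n
    using le[of "Suc n"] by (simp only: lessThan_Suc_atMost)
  then have "summable a"
    by (intro bounded_imp_summable[of a S]) (simp_all add: a_def)
  then show ?thesis using suminf_le_const le by blast
qed

section \<open>Logarithmic coefficients\<close>

text \<open>Differentiating exp L = f(z)/z gives z L' = z f'/f - 1 off the origin. At the origin z
  L' is 0 and the quotient has the value 1.\<close>

lemma log_quotient_deriv:
  assumes f: "f \<in> class_S \<alpha> \<beta>" and L: "is_log_quotient f L" and z: "z \<in> ball 0 1"
  shows "\<alpha> - 1 < Re (z * deriv L z) \<and> Re (z * deriv L z) < \<beta> - 1"
proof -
  have q: "\<alpha> < Re (if z = 0 then 1 else z * deriv f z / f z) \<and> Re (if z = 0 then 1 else z * deriv f z / f z) < \<beta>"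
    using f z unfolding class_S_def Let_def by blast
  show ?thesis
  proof (cases "z = 0")
    case True
    then show ?thesis using q by simp
  next
    case False
    have L_hol: "L holomorphic_on ball 0 1" and L_eq: "\<And>w. w \<in> ball 0 1 - {0} \<Longrightarrow> exp (L w) = f w / w"
      using L by (auto simp: is_log_quotient_def)
    have f_hol: "f holomorphic_on ball 0 1" and fz: "f z \<noteq> 0"
      using f z False by (auto simp: class_S_def class_A_def)
    have "(f has_field_derivative deriv f z) (at z)" "(L has_field_derivative deriv L z) (at z)"
      using f_hol L_hol z holomorphic_derivI by blast+
    then have d1: "((\<lambda>w. exp (L w)) has_field_derivative exp (L z) * deriv L z) (at z)"
      and d2: "((\<lambda>w. f w / w) has_field_derivative (deriv f z * z - f z) / (z * z)) (at z)"
      using False by (auto intro!: derivative_eq_intros)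
    have "((\<lambda>w. f w / w) has_field_derivative exp (L z) * deriv L z) (at z)"
      by (rule has_field_derivative_transform_within_open[OF d1, of "ball 0 1 - {0}"])
         (use z False L_eq in \<open>auto intro!: open_delete\<close>)
    from DERIV_unique[OF this d2] have "f z / z * deriv L z = (deriv f z * z - f z) / (z * z)"
      using L_eq[of z] z False by simp
    then have "z * deriv L z = z * deriv f z / f z - 1"
      using fz False by (simp add: field_simps)
    then show ?thesis using q False by simp
  qed
qed

text \<open>\<open>log_coeff\<close> comes with some logarithm \<open>M\<close>; uniqueness of the
  normalised logarithm identifies it with the given \<open>L\<close>.\<close>

lemma log_coeff_expansion:
  assumes f: "f \<in> class_S \<alpha> \<beta>" and L: "is_log_quotient f L"
  shows "fps_nth (fps_expansion L 0) n = 2 * log_coeff f n"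
proof -
  have "is_log_coeffs f (log_coeff f)"
    unfolding log_coeff_def by (rule theI'[OF ex1_log_coeffs[OF f]])
  then obtain M where M: "is_log_quotient f M" and c0: "log_coeff f 0 = 0"
    and s: "\<And>z. z \<in> ball 0 1 \<Longrightarrow> (\<lambda>n. 2 * log_coeff f (Suc n) * z ^ Suc n) sums M z"
    unfolding is_log_coeffs_def by blast
  have "(\<lambda>n. 2 * log_coeff f n * z ^ n) sums L z" if "z \<in> ball 0 1" for z
    using s[OF that] c0 log_quotient_unique[OF L M that]
      sums_Suc_iff[of "\<lambda>n. 2 * log_coeff f n * z ^ n" "L z"] by simp
  then have "L has_fps_expansion Abs_fps (\<lambda>n. 2 * log_coeff f n)"
    by (intro has_fps_expansionI eventually_nhds_in_open[of "ball 0 1", THEN eventually_mono]) auto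
  then show ?thesis by (simp add: fps_expansion_eqI)
qed

lemma fps_expansion_z_deriv:
  assumes "L holomorphic_on ball 0 1"
  shows "fps_nth (fps_expansion (\<lambda>z. c * (z * deriv L z)) 0) n = c * (of_nat n * fps_nth (fps_expansion L 0) n)"
proof -
  have "L has_fps_expansion fps_expansion L 0"
    using has_fps_expansion_fps_expansion[OF _ _ assms] by simp
  then have "(\<lambda>z. c * (z * deriv L z)) has_fps_expansion fps_const c * (fps_X * fps_deriv (fps_expansion L 0))"
    by (intro fps_expansion_intros)
  then show ?thesis by (simp add: fps_expansion_eqI)
qed

text \<open>Take \<open>L\<close> to be the primitive of q(z)/z vanishing at 0 and f(z) = z exp (L
  z); then z f'/f = 1 + q. This produces the extremal function.\<close>

lemma exists_log_quotient_with_deriv: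
  assumes q: "q holomorphic_on ball 0 1" "q 0 = 0"
    and bounds: "\<And>z. z \<in> ball 0 1 \<Longrightarrow> \<alpha> - 1 < Re (q z) \<and> Re (q z) < \<beta> - 1"
  obtains f L where "f \<in> class_S \<alpha> \<beta>" "is_log_quotient f L" "\<And>z. z \<in> ball 0 1 \<Longrightarrow> z * deriv L z = q z"
proof -
  \<comment> \<open>The value \<open>deriv q 0\<close> removes the singularity of q(z)/z.\<close>
  define h where "h = (\<lambda>z. if z = 0 then deriv q 0 else q z / z)"
  have "h holomorphic_on ball 0 1"
    using pole_theorem_0[OF q(1), of 0 h] q(2) by (auto simp: h_def)
  then obtain M where M: "\<And>z. z \<in> ball 0 1 \<Longrightarrow> (M has_field_derivative h z) (at z)"
    using holomorphic_convex_primitive'[of "ball 0 1" h] by (metis at_within_open convex_ball open_ball)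
  define L where "L = (\<lambda>z. M z - M 0)"
  define f where "f = (\<lambda>z. z * exp (L z))"
  have dL: "(L has_field_derivative h z) (at z)" if "z \<in> ball 0 1" for z
    unfolding L_def using M[OF that] by (auto intro!: derivative_eq_intros)
  have zh: "z * h z = q z" for z using q(2) by (simp add: h_def)
  have L_hol: "L holomorphic_on ball 0 1"
    using dL by (meson holomorphic_on_open open_ball)
  have df: "deriv f z = exp (L z) * (1 + q z)" if "z \<in> ball 0 1" for z
  proof -
    have "(f has_field_derivative exp (L z) + exp (L z) * h z * z) (at z)"
      unfolding f_def using dL[OF that] by (auto intro!: derivative_eq_intros)
    then have "deriv f z = exp (L z) + exp (L z) * h z * z" by (rule DERIV_imp_deriv)
    then show ?thesis using zh[of z] by (simp add: algebra_simps)
  qed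
  have L0: "L 0 = 0" by (simp add: L_def)
  have "f \<in> class_A"
    using L_hol df[of 0] L0 q(2) by (auto simp: class_A_def f_def intro!: holomorphic_intros)
  moreover have "\<alpha> < Re (if z = 0 then 1 else z * deriv f z / f z)
      \<and> Re (if z = 0 then 1 else z * deriv f z / f z) < \<beta>" if "z \<in> ball 0 1" for z
  proof -
    have "(if z = 0 then 1 else z * deriv f z / f z) = 1 + q z"
      using df[OF that] q(2) by (simp add: f_def)
    then show ?thesis using bounds[OF that] by simp
  qed
  moreover have "f z \<noteq> 0" if "z \<noteq> 0" for z
    using that by (simp add: f_def)
  ultimately have "f \<in> class_S \<alpha> \<beta>"
    unfolding class_S_def Let_def by blast
  moreover have "is_log_quotient f L"
    using L_hol L0 by (auto simp: is_log_quotient_def f_def)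
  moreover have "z * deriv L z = q z" if "z \<in> ball 0 1" for z
    using DERIV_imp_deriv[OF dL[OF that]] zh by simp
  ultimately show ?thesis using that by blast
qed

section \<open>The sharp inequality for the logarithmic coefficients\<close>

theorem theorem2p2:
  fixes \<alpha> \<beta> :: real
  assumes "\<alpha> < 1" and "1 < \<beta>"
  shows "let B = complex_of_real ((\<beta> - \<alpha>)\<^sup>2 / (4 * pi\<^sup>2)) *
               (complex_of_real (pi ^ 4 / 45)
                - Li4 (exp (- 2 * complex_of_real pi * \<i> * complex_of_real ((1 - \<alpha>) / (\<beta> - \<alpha>))))
                - Li4 (exp (2 * complex_of_real pi * \<i> * complex_of_real ((1 - \<alpha>) / (\<beta> - \<alpha>)))))
         in B \<in> \<real> \<and>
            (\<forall>f\<in>class_S \<alpha> \<beta>.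
               summable (\<lambda>n. (cmod (log_coeff f (Suc n)))\<^sup>2) \<and>
               (\<Sum>n. (cmod (log_coeff f (Suc n)))\<^sup>2) \<le> Re B) \<and>
            (\<exists>f\<in>class_S \<alpha> \<beta>.
               (\<Sum>n. (cmod (log_coeff f (Suc n)))\<^sup>2) = Re B)"
proof -
  define \<delta> where "\<delta> = \<beta> - \<alpha>"
  define \<phi> where "\<phi> = pi * ((1 - \<alpha>) / \<delta>)"
  define C where "C = complex_of_real (pi ^ 4 / 45) - Li4 (cis (- (2 * \<phi>))) - Li4 (cis (2 * \<phi>))"
  define b where "b = (\<lambda>n. (cmod ((1 - cis (2 * \<phi>) ^ Suc n) / of_nat (Suc n)))\<^sup>2 / (real (Suc n))\<^sup>2)"
  have \<delta>: "0 < \<delta>" using assms by (simp add: \<delta>_def)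
  have \<phi>: "0 < \<phi>" "\<phi> < pi" using assms by (auto simp: \<phi>_def \<delta>_def field_simps)
  \<comment> \<open>Multiplication by -i pi/\<delta> carries the strip \<alpha> - 1 < Re < \<beta> -
    1 onto \<phi> - pi < Im < \<phi>; these are its two edges.\<close>
  have ends: "pi / \<delta> * (1 - \<alpha>) = \<phi>" "pi / \<delta> * (1 - \<beta>) = \<phi> - pi"
    using \<delta> by (simp_all add: \<phi>_def \<delta>_def field_simps)
  have exps: "exp (- 2 * complex_of_real pi * \<i> * complex_of_real ((1 - \<alpha>) / (\<beta> - \<alpha>))) = cis (- (2 * \<phi>))"
    "exp (2 * complex_of_real pi * \<i> * complex_of_real ((1 - \<alpha>) / (\<beta> - \<alpha>))) = cis (2 * \<phi>)"
    unfolding cis_conv_exp by (simp_all add: \<phi>_def \<delta>_def mult_ac)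
  have bC: "(\<lambda>n. complex_of_real (b n)) sums C"
    unfolding b_def C_def by (rule extremal_sums)
  \<comment> \<open>\<open>C\<close> is a sum of real terms, so its imaginary part is the sum of the
    zero series.\<close>
  then have bR: "b sums Re C" and "C = of_real (Re C)"
    using sums_Re[OF bC] sums_Im[OF bC] sums_unique2[OF sums_zero, of "Im C"]
    by (simp_all add: complex_eq_iff)
  then have "C \<in> \<real>" by (metis Reals_of_real)
  \<comment> \<open>Inverse of the factor 4 pi^2/\<delta>^2 that arises from |(pi/\<delta>) 2 n
    \<gamma>_n|^2 / n^2.\<close>
  define k where "k = \<delta>\<^sup>2 / (4 * pi\<^sup>2)"
  have coeff: "(cmod (log_coeff f (Suc n)))\<^sup>2
      = k * ((cmod (fps_nth (fps_expansion (\<lambda>z. - \<i> * of_real (pi / \<delta>) * (z * deriv L z)) 0) (Suc n)))\<^sup>2 / (real (Suc n))\<^sup>2)"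
    if "f \<in> class_S \<alpha> \<beta>" "is_log_quotient f L" for f L n
  proof -
    have "L holomorphic_on ball 0 1" using that(2) by (simp add: is_log_quotient_def)
    from fps_expansion_z_deriv[OF this, of "- \<i> * of_real (pi / \<delta>)" "Suc n"] log_coeff_expansion[OF that, of "Suc n"]
    have "fps_nth (fps_expansion (\<lambda>z. - \<i> * of_real (pi / \<delta>) * (z * deriv L z)) 0) (Suc n)
        = - \<i> * of_real (pi / \<delta>) * (of_nat (Suc n) * (2 * log_coeff f (Suc n)))" by simp
    then show ?thesis
      using \<delta> by (simp add: norm_mult norm_divide k_def power_mult_distrib power_divide del: of_nat_Suc)
  qed
  have bound: "summable (\<lambda>n. (cmod (log_coeff f (Suc n)))\<^sup>2) \<and> (\<Sum>n. (cmod (log_coeff f (Suc n)))\<^sup>2) \<le> k * Re C"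
    if f: "f \<in> class_S \<alpha> \<beta>" for f
  proof -
    obtain L where L: "is_log_quotient f L" using ex_log_quotient[OF f] by blast
    define g where "g = (\<lambda>z. - \<i> * of_real (pi / \<delta>) * (z * deriv L z))"
    have "g holomorphic_on ball 0 1"
      using L unfolding g_def is_log_quotient_def by (intro holomorphic_intros) auto
    moreover have "\<phi> - pi < Im (g z) \<and> Im (g z) < \<phi>" if "z \<in> ball 0 1" for z
    proof -
      have "Im (g z) = pi / \<delta> * - Re (z * deriv L z)" using \<delta> by (simp add: g_def field_simps)
      moreover have "1 - \<beta> < - Re (z * deriv L z)" "- Re (z * deriv L z) < 1 - \<alpha>"
        using log_quotient_deriv[OF f L that] by auto
      then have "pi / \<delta> * (1 - \<beta>) < pi / \<delta> * - Re (z * deriv L z)"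
        "pi / \<delta> * - Re (z * deriv L z) < pi / \<delta> * (1 - \<alpha>)"
        using \<delta> by (intro mult_strict_left_mono; simp)+
      ultimately show ?thesis unfolding ends by simp
    qed
    ultimately obtain summable: "summable (\<lambda>n. (cmod (fps_nth (fps_expansion g 0) (Suc n)))\<^sup>2 / (real (Suc n))\<^sup>2)"
      and le: "(\<Sum>n. (cmod (fps_nth (fps_expansion g 0) (Suc n)))\<^sup>2 / (real (Suc n))\<^sup>2) \<le> Re C"
      using strip_weighted_sum_bound[OF \<phi> _ _ _ bR[unfolded b_def], of g] by (auto simp: g_def)
    have "0 \<le> k" by (simp add: k_def)
    then show ?thesis
      unfolding coeff[OF f L] g_def[symmetric] suminf_mult[OF summable]
      by (intro conjI summable_mult[OF summable] mult_left_mono[OF le])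
  qed
  have sharp: "\<exists>f\<in>class_S \<alpha> \<beta>. (\<Sum>n. (cmod (log_coeff f (Suc n)))\<^sup>2) = k * Re C"
  proof -
    \<comment> \<open>The factor is the inverse of -i pi/\<delta>, so the rescaled z L' is
      \<open>half_plane_log \<phi>\<close> itself and the two series agree term by term.\<close>
    define q where "q = (\<lambda>z. \<i> * of_real (\<delta> / pi) * half_plane_log \<phi> z)"
    have "q holomorphic_on ball 0 1" "q 0 = 0"
      unfolding q_def by (intro holomorphic_intros holomorphic_half_plane_log) (simp add: half_plane_log_def)
    moreover have "\<alpha> - 1 < Re (q z) \<and> Re (q z) < \<beta> - 1" if "z \<in> ball 0 1" for z
    proof -
      have "Im (half_plane_log \<phi> z) = pi / \<delta> * - Re (q z)" using \<delta> by (simp add: q_def)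
      then have "pi / \<delta> * (1 - \<beta>) < pi / \<delta> * - Re (q z)" "pi / \<delta> * - Re (q z) < pi / \<delta> * (1 - \<alpha>)"
        unfolding ends using half_plane_log_in_strip[OF \<phi>, of z] that by auto
      then show ?thesis using \<delta> by (simp only: mult_less_cancel_left_pos divide_pos_pos pi_gt_zero) linarith
    qed
    ultimately obtain f L where f: "f \<in> class_S \<alpha> \<beta>" and L: "is_log_quotient f L"
      and Lq: "\<And>z. z \<in> ball 0 1 \<Longrightarrow> z * deriv L z = q z"
      using exists_log_quotient_with_deriv[of q \<alpha> \<beta>] by metis
    have "\<forall>\<^sub>F z in nhds 0. half_plane_log \<phi> z = - \<i> * of_real (pi / \<delta>) * (z * deriv L z)"
      using \<delta> Lq by (intro eventually_nhds_in_open[of "ball 0 1", THEN eventually_mono]) (auto simp: q_def)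
    then have "(\<lambda>z. - \<i> * of_real (pi / \<delta>) * (z * deriv L z)) has_fps_expansion
        Abs_fps (\<lambda>n. (1 - cis (2 * \<phi>) ^ n) / of_nat n)"
      using half_plane_log_has_fps_expansion[of \<phi>] by (subst (asm) has_fps_expansion_cong) auto
    then have "(cmod (log_coeff f (Suc n)))\<^sup>2 = k * b n" for n
      unfolding coeff[OF f L] by (simp add: fps_expansion_eqI b_def)
    then have "(\<lambda>n. (cmod (log_coeff f (Suc n)))\<^sup>2) sums (k * Re C)"
      using sums_mult[OF bR, of k] by simp
    then have "(\<Sum>n. (cmod (log_coeff f (Suc n)))\<^sup>2) = k * Re C"
      by (rule sums_unique[symmetric])
    then show ?thesis using f by (rule bexI)
  qed
  have kC: "complex_of_real k * C \<in> \<real>" "Re (complex_of_real k * C) = k * Re C"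
    using \<open>C \<in> \<real>\<close> by (simp_all add: Reals_mult)
  show ?thesis
    unfolding Let_def exps
    unfolding C_def[symmetric] \<delta>_def[symmetric] k_def[symmetric] kC(2)
    by (intro conjI kC(1) ballI[OF bound] sharp)
qed

end
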